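(* Let $(\mathcal{R},\partial)$ be a differential ring with ring of constants $\mathcal{C}$ such that $\partial\mathcal{R}=\mathcal{R}$, and let $e\colon\mathcal{R}\to\mathcal{C}$ be an evaluation on $\mathcal{R}$. Define $\int_e\colon\mathcal{R}\to\mathcal{R}$ by $$\textstyle\int_e f := g-eg$$ for all $f\in\mathcal{R}$, where $g\in\mathcal{R}$ is such that $\partial g=f$. Then $(\mathcal{R},\partial,\int_e)$ is an integro-differential ring (in particular $\int_e$ is well defined) and its induced evaluation is $\mathrm{E}=e$. Moreover, any integration $\int$ on $\mathcal{R}$ can be obtained from its induced evaluation $\mathrm{E}$ via this construction: $\int=\int_{\mathrm{E}}$.
   Context: Rings are unital, nonzero, not necessarily commutative, of arbitrary characteristic. A derivation on a ring $\mathcal{R}$ is an additive map $\partial$ with $\partial(fg)=(\partial f)g+f\,\partial g$; then $(\mathcal{R},\partial)$ is a differential ring and $\mathcal{C}=\{f\in\mathcal{R}:\partial f=0\}$ is its ring of constants (a subring). "$\mathcal{C}$-linear" means homomorphism of $\mathcal{C}$-bimodules. An integration on $\mathcal{R}$ is a $\mathcal{C}$-linear map $\int\colon\mathcal{R}\to\mathcal{R}$ with $\partial\int f=f$ for all $f\in\mathcal{R}$. An evaluation on $\mathcal{R}$ is a $\mathcal{C}$-linear map $e\colon\mathcal{R}\to\mathcal{C}$ which acts on $\mathcal{C}$ as the identity. An integro-differential ring $(\mathcal{R},\partial,\int)$ is a differential ring with an integration; its induced evaluation is $\mathrm{E}f:=f-\int\partial f$. *)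

theory Defs
  imports Complex_Main
begin

(* The ring is the whole type 'a :: ring_1; this class is unital, nonzero and
   not necessarily commutative. *)

definition derivation :: "('a::ring_1 \<Rightarrow> 'a) \<Rightarrow> bool" where
  "derivation d \<longleftrightarrow> Modules.additive d \<and> (\<forall>f g. d (f * g) = d f * g + f * d g)"

definition constants :: "('a::ring_1 \<Rightarrow> 'a) \<Rightarrow> 'a set" where
  "constants d = {f. d f = 0}"

definition constants_linear :: "('a::ring_1 \<Rightarrow> 'a) \<Rightarrow> ('a \<Rightarrow> 'a) \<Rightarrow> bool" where
  "constants_linear d L \<longleftrightarrow>
     Modules.additive L \<and> (\<forall>c\<in>constants d. \<forall>f. L (c * f) = c * L f \<and> L (f * c) = L f * c)"

definition integration :: "('a::ring_1 \<Rightarrow> 'a) \<Rightarrow> ('a \<Rightarrow> 'a) \<Rightarrow> bool" where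
  "integration d I \<longleftrightarrow> constants_linear d I \<and> (\<forall>f. d (I f) = f)"

(* A map into the ring of constants is a map into the ring whose values are constants. *)
definition evaluation :: "('a::ring_1 \<Rightarrow> 'a) \<Rightarrow> ('a \<Rightarrow> 'a) \<Rightarrow> bool" where
  "evaluation d e \<longleftrightarrow>
     constants_linear d e \<and> range e \<subseteq> constants d \<and> (\<forall>c\<in>constants d. e c = c)"

definition integro_differential_ring :: "('a::ring_1 \<Rightarrow> 'a) \<Rightarrow> ('a \<Rightarrow> 'a) \<Rightarrow> bool" where
  "integro_differential_ring d I \<longleftrightarrow> derivation d \<and> integration d I"

definition induced_evaluation :: "('a::ring_1 \<Rightarrow> 'a) \<Rightarrow> ('a \<Rightarrow> 'a) \<Rightarrow> 'a \<Rightarrow> 'a" where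
  "induced_evaluation d I f = f - I (d f)"

definition integral_value :: "('a::ring_1 \<Rightarrow> 'a) \<Rightarrow> ('a \<Rightarrow> 'a) \<Rightarrow> 'a \<Rightarrow> 'a \<Rightarrow> bool" where
  "integral_value d e f h \<longleftrightarrow> (\<exists>g. d g = f \<and> h = g - e g)"

(* Meaningful only where integral_value d e f has exactly one solution, that is, where
   g - e g exists and does not depend on the chosen antiderivative g of f. *)
definition integral_of_evaluation :: "('a::ring_1 \<Rightarrow> 'a) \<Rightarrow> ('a \<Rightarrow> 'a) \<Rightarrow> 'a \<Rightarrow> 'a" where
  "integral_of_evaluation d e f = (THE h. integral_value d e f h)"

end

theory Submission
  imports Defs
begin

text \<open>Two antiderivatives of the same element differ by a constant, and \<open>g \<mapsto> g - e g\<close> kills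
  exactly the constants. Hence the integral attached to an evaluation \<open>e\<close> is characterised by
  \<open>d g \<mapsto> g - e g\<close>, and all claims follow by writing every element as \<open>d g\<close>.\<close>

lemma derivation_additive: "derivation d \<Longrightarrow> Modules.additive d"
  by (simp add: derivation_def)

lemma derivation_mult: "derivation d \<Longrightarrow> d (f * g) = d f * g + f * d g"
  by (simp add: derivation_def)

text \<open>In the Leibniz rule the term containing \<open>d c\<close> vanishes, so \<open>d\<close>
  is linear over its constants on both sides.\<close>

lemma derivation_constant_mult:
  assumes "derivation d" "c \<in> constants d"
  shows "d (c * f) = c * d f" "d (f * c) = d f * c"
  using assms by (simp_all add: derivation_mult constants_def)

lemma evaluation_additive: "evaluation d e \<Longrightarrow> Modules.additive e"
  by (simp add: evaluation_def constants_linear_def)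

lemma evaluation_constant_mult:
  assumes "evaluation d e" "c \<in> constants d"
  shows "e (c * f) = c * e f" "e (f * c) = e f * c"
  using assms by (simp_all add: evaluation_def constants_linear_def)

lemma derivation_evaluation: "evaluation d e \<Longrightarrow> d (e f) = 0"
  by (auto simp: evaluation_def constants_def)

lemma evaluation_constant: "evaluation d e \<Longrightarrow> d c = 0 \<Longrightarrow> e c = c"
  by (simp add: evaluation_def constants_def)

text \<open>Settles existence and uniqueness of the value together: \<open>g\<close> itself is a
  witness, and any other antiderivative yields the same element.\<close>

lemma integral_value_derivation_iff:
  assumes "derivation d" "evaluation d e"
  shows "integral_value d e (d g) h \<longleftrightarrow> h = g - e g"
proof
  assume "integral_value d e (d g) h"
  then obtain g' where g': "d g' = d g" and h: "h = g' - e g'"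
    by (auto simp: integral_value_def)
  have "d (g' - g) = 0"
    using g' additive.diff[OF derivation_additive[OF assms(1)]] by simp
  \<comment> \<open>The difference is a constant, so \<open>e\<close> fixes it; additivity then
    splits \<open>e (g' - g)\<close>.\<close>
  then have "g' - g = e g' - e g"
    using evaluation_constant[OF assms(2)] additive.diff[OF evaluation_additive[OF assms(2)]]
    by metis
  then show "h = g - e g"
    unfolding h by (simp add: algebra_simps)
qed (auto simp: integral_value_def)

text \<open>Turns the definite description into an explicit formula; with \<open>d\<close>
  surjective it determines the integral everywhere.\<close>

lemma integral_of_evaluation_derivation:
  assumes "derivation d" "evaluation d e"
  shows "integral_of_evaluation d e (d g) = g - e g"
  using assms by (simp add: integral_of_evaluation_def integral_value_derivation_iff)

lemma integration_integral_of_evaluation: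
  assumes "derivation d" "surj d" "evaluation d e"
  shows "integration d (integral_of_evaluation d e)"
proof -
  note d_additive = derivation_additive[OF assms(1)]
  note e_additive = evaluation_additive[OF assms(3)]
  note integral = integral_of_evaluation_derivation[OF assms(1,3)]
  let ?I = "integral_of_evaluation d e"
  have "?I (f + f') = ?I f + ?I f'" for f f'
  proof -
    obtain g g' where "f = d g" "f' = d g'"
      using assms(2) by (meson surjD)
    then show ?thesis
      \<comment> \<open>Additivity of \<open>d\<close> makes \<open>g + g'\<close> an antiderivative
        of \<open>f + f'\<close>.\<close>
      using integral[of "g + g'"]
      by (simp add: integral additive.add[OF d_additive] additive.add[OF e_additive])
  qed
  moreover have "?I (c * f) = c * ?I f \<and> ?I (f * c) = ?I f * c" if "c \<in> constants d" for c f
  proof -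
    obtain g where "f = d g"
      using assms(2) by (meson surjD)
    then show ?thesis
      \<comment> \<open>As \<open>c\<close> is a constant, these are antiderivatives of
        \<open>c * f\<close> and \<open>f * c\<close>.\<close>
      using integral[of "c * g"] integral[of "g * c"]
      by (simp add: integral derivation_constant_mult[OF assms(1) that]
          evaluation_constant_mult[OF assms(3) that] algebra_simps)
  qed
  moreover have "d (?I f) = f" for f
  proof -
    obtain g where "f = d g"
      using assms(2) by (meson surjD)
    then show ?thesis
      by (simp add: integral additive.diff[OF d_additive] derivation_evaluation[OF assms(3)])
  qed
  ultimately show ?thesis
    by (simp add: integration_def constants_linear_def additive_def)
qed

text \<open>Since \<open>g\<close> and \<open>I (d g)\<close> have the same derivative, their
  difference is a constant; for constant \<open>g\<close> it is \<open>g - I 0 = g\<close>.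
  Linearity is inherited from \<open>d\<close> and \<open>I\<close>.\<close>

lemma evaluation_induced_evaluation:
  assumes "derivation d" "integration d I"
  shows "evaluation d (induced_evaluation d I)"
proof -
  note d_additive = derivation_additive[OF assms(1)]
  have I_additive: "Modules.additive I"
    and I_mult: "\<And>c f. c \<in> constants d \<Longrightarrow> I (c * f) = c * I f \<and> I (f * c) = I f * c"
    and d_I: "\<And>f. d (I f) = f"
    using assms(2) by (auto simp: integration_def constants_linear_def)
  have "constants_linear d (induced_evaluation d I)"
    by (simp add: constants_linear_def additive_def induced_evaluation_def I_mult
        derivation_constant_mult[OF assms(1)] additive.add[OF d_additive]
        additive.add[OF I_additive] algebra_simps)
  moreover have "range (induced_evaluation d I) \<subseteq> constants d"
    by (auto simp: induced_evaluation_def constants_def additive.diff[OF d_additive] d_I)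
  moreover have "\<forall>c\<in>constants d. induced_evaluation d I c = c"
    by (simp add: induced_evaluation_def constants_def additive.zero[OF I_additive])
  ultimately show ?thesis
    by (simp add: evaluation_def)
qed

theorem theorem2p4:
  fixes d :: "'a::ring_1 \<Rightarrow> 'a"
  assumes "derivation d"
    and "surj d"
  shows "(\<forall>e. evaluation d e \<longrightarrow>
            (\<forall>f. \<exists>!h. integral_value d e f h) \<and>
            integro_differential_ring d (integral_of_evaluation d e) \<and>
            induced_evaluation d (integral_of_evaluation d e) = e) \<and>
         (\<forall>I. integration d I \<longrightarrow>
            evaluation d (induced_evaluation d I) \<and>
            I = integral_of_evaluation d (induced_evaluation d I))"
proof (intro conjI allI impI)
  fix e f
  assume e: "evaluation d e"
  obtain g where "f = d g"
    using assms(2) by (meson surjD)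
  then show "\<exists>!h. integral_value d e f h"
    by (simp add: integral_value_derivation_iff[OF assms(1) e])
next
  fix e
  assume e: "evaluation d e"
  show "integro_differential_ring d (integral_of_evaluation d e)"
    using assms integration_integral_of_evaluation[OF assms e]
    by (simp add: integro_differential_ring_def)
  show "induced_evaluation d (integral_of_evaluation d e) = e"
    \<comment> \<open>Integrating \<open>d g\<close> gives \<open>g - e g\<close>, and
      \<open>g - (g - e g) = e g\<close>.\<close>
    by (simp add: fun_eq_iff induced_evaluation_def
        integral_of_evaluation_derivation[OF assms(1) e])
next
  fix I
  assume I: "integration d I"
  show E: "evaluation d (induced_evaluation d I)"
    by (rule evaluation_induced_evaluation[OF assms(1) I])
  show "I = integral_of_evaluation d (induced_evaluation d I)"
  proof
    fix f
    obtain g where "f = d g"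
      using assms(2) by (meson surjD)
    then show "I f = integral_of_evaluation d (induced_evaluation d I) f"
      \<comment> \<open>The right-hand side becomes \<open>g - (g - I (d g))\<close>, which is
        \<open>I (d g)\<close>.\<close>
      by (simp add: integral_of_evaluation_derivation[OF assms(1) E])
        (simp add: induced_evaluation_def)
  qed
qed

end
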